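(* Let $k$ be a field with $\operatorname{char}(k)\neq 2,3$. Let $r,s\in k\setminus\{0,1\}$ and suppose that $[x,y]=[j(r)+j(s),\,j(r)j(s)]$ is a point of $\mathbb{A}\setminus H$, where $H=\{[x,y]\in\mathbb{A}:x=y+1\}$. Then $$\tau([x,y])=\left[\,j(r^\circ)+j(s^\circ),\ j(r^\circ)\,j(s^\circ)\,\right].$$
   Context: $j(r)=\frac{4(r^2-r+1)^3}{27r^2(r-1)^2}$ for $r\neq 0,1$, and $w^\circ=\frac{2-w}{1+w}$ for $w\neq -1,2,1/2$. The Pappus-Steiner map is $\pi([x,y])=\left[\frac{2y(y-x+2)}{(x-y)^2},\frac{y^2}{(x-y)^2}\right]$, defined on points of $k^2$ with $x\neq y$. Let $W_1=\{[x,y]\in k^2: x=y\}$ and $W_n=\{[x,y]\in k^2\setminus\bigcup_{i=1}^{n-1}W_i:\ \pi([x,y])\in W_{n-1}\}$ for $n\geq 2$, and $\mathbb{A}=k^2\setminus\bigcup_{i\ge 1}W_i$. The involution $\tau$ (exchanging the two preimages of points under $\pi$) is given on $\mathbb{A}\setminus H$ by $\tau([x,y])=\left[\frac{2y-x}{y-x+1},\frac{y}{y-x+1}\right]$. *)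

theory Defs
  imports Main
begin

definition j_inv :: "'a::field \<Rightarrow> 'a" where
  "j_inv r = 4 * (r^2 - r + 1)^3 / (27 * r^2 * (r - 1)^2)"

definition circ :: "'a::field \<Rightarrow> 'a" where
  "circ w = (2 - w) / (1 + w)"

text \<open>Points of \<open>k\<^sup>2\<close> are pairs. The value on the diagonal is meaningless and never used.\<close>

definition pappus_steiner :: "'a::field \<times> 'a \<Rightarrow> 'a \<times> 'a" where
  "pappus_steiner = (\<lambda>(x, y). (2 * y * (y - x + 2) / (x - y)^2, y^2 / (x - y)^2))"

text \<open>Indices start at \<open>1\<close>; \<open>W 0\<close> is a dummy value.\<close>

fun W :: "nat \<Rightarrow> ('a::field \<times> 'a) set" where
  "W n = (if n = 0 then {}
          else if n = 1 then {(x, y). x = y}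
          else {p. (\<forall>i\<in>{1..n - 1}. p \<notin> W i) \<and> pappus_steiner p \<in> W (n - 1)})"

declare W.simps [simp del]

definition \<A> :: "('a::field \<times> 'a) set" where
  "\<A> = UNIV - (\<Union>i\<in>{1..}. W i)"

definition H :: "('a::field \<times> 'a) set" where
  "H = {(x, y) \<in> \<A>. x = y + 1}"

text \<open>The formula is only used on \<open>\<A> - H\<close>. The lemmas on \<open>tau\<close> below show that there it is the
  involution exchanging the two preimages of each point under \<open>pappus_steiner\<close>.\<close>

definition tau :: "'a::field \<times> 'a \<Rightarrow> 'a \<times> 'a" where
  "tau = (\<lambda>(x, y). ((2 * y - x) / (y - x + 1), y / (y - x + 1)))"

lemma two_three_neq_0:
  assumes "CHAR('a::field) \<noteq> 2" "CHAR('a) \<noteq> 3"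
  shows "(2::'a) \<noteq> 0" "(3::'a) \<noteq> 0"
proof -
  have 1: "CHAR('a) \<noteq> 1"
    using of_nat_CHAR[where 'a = 'a] by (metis of_nat_1 zero_neq_one)
  have dvd2: "c = 1 \<or> c = 2" if "c dvd 2" for c :: nat
    using that dvd_imp_le[of c 2] by (cases "c = 0") auto
  have "\<not> CHAR('a) dvd 2" using assms 1 dvd2 by blast
  then show "(2::'a) \<noteq> 0" using of_nat_eq_0_iff_char_dvd[of 2, where 'a = 'a] by simp
  have dvd3: "c = 1 \<or> c = 3" if "c dvd 3" for c :: nat
  proof -
    have "c \<le> 3" "c \<noteq> 0" "c \<noteq> 2" using that dvd_imp_le[of c 3] by (auto intro!: Nat.gr0I)
    then show ?thesis by linarith
  qed
  have "\<not> CHAR('a) dvd 3" using assms 1 dvd3 by blast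
  then show "(3::'a) \<noteq> 0" using of_nat_eq_0_iff_char_dvd[of 3, where 'a = 'a] by simp
qed

lemma W_1: "W 1 = {(x, y). x = y}"
  by (simp add: W.simps)

lemma W_ge_2:
  assumes "n \<ge> 2"
  shows "W n = {p. p \<notin> (\<Union>i\<in>{1..n - 1}. W i) \<and> pappus_steiner p \<in> W (n - 1)}"
  using assms by (subst W.simps) auto

lemma mem_A_iff: "p \<in> \<A> \<longleftrightarrow> fst p \<noteq> snd p \<and> pappus_steiner p \<in> \<A>"
proof
  assume p: "p \<in> \<A>"
  then have n: "p \<notin> W i" if "i \<ge> 1" for i using that by (auto simp: \<A>_def)
  have "pappus_steiner p \<notin> W i" if "i \<ge> 1" for i
    using n[of "Suc i"] n that by (simp add: W_ge_2[of "Suc i"])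
  then show "fst p \<noteq> snd p \<and> pappus_steiner p \<in> \<A>"
    using n[of 1] by (auto simp: \<A>_def W_1 split_beta simp del: One_nat_def)
next
  assume p: "fst p \<noteq> snd p \<and> pappus_steiner p \<in> \<A>"
  have "p \<notin> W i" if "i \<ge> 1" for i
  proof (cases "i = 1")
    case True
    then show ?thesis using p by (auto simp: W_1 simp del: One_nat_def)
  next
    case False
    then have "pappus_steiner p \<notin> W (i - 1)" using p that by (auto simp: \<A>_def)
    then show ?thesis using False that by (simp add: W_ge_2[of i])
  qed
  then show "p \<in> \<A>" by (auto simp: \<A>_def)
qed

lemma A_snd_neq_0:
  assumes "p \<in> \<A>" shows "snd p \<noteq> 0"
proof
  assume "snd p = 0"
  then have "pappus_steiner p = (0, 0)" by (auto simp: pappus_steiner_def split_beta)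
  then have "(0, 0) \<in> (\<A> :: ('a \<times> 'a) set)" using assms mem_A_iff[of p] by simp
  then show False using mem_A_iff[of "(0, 0) :: 'a \<times> 'a"] by simp
qed

context
  fixes p :: "'a::field \<times> 'a"
  assumes char: "CHAR('a) \<noteq> 2" "CHAR('a) \<noteq> 3"
  assumes p: "p \<in> \<A> - H"
begin

private lemma coords:
  obtains d y where "p = (d + y, y)" "d \<noteq> 0" "d \<noteq> 1" "y \<noteq> 0"
    "tau p = ((y - d) / (1 - d), y / (1 - d))"
proof
  let ?d = "fst p - snd p" and ?y = "snd p"
  show "p = (?d + ?y, ?y)" by simp
  show "?d \<noteq> 0" using p mem_A_iff[of p] by simp
  show "?d \<noteq> 1" using p by (auto simp: H_def split_beta algebra_simps)
  show "?y \<noteq> 0" using p A_snd_neq_0 by blast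
  show "tau p = ((?y - ?d) / (1 - ?d), ?y / (1 - ?d))"
    by (simp add: tau_def split_beta algebra_simps)
qed

lemma tau_diff: "fst (tau p) \<noteq> snd (tau p)"
proof (rule coords)
  fix d y assume "d \<noteq> 0" "d \<noteq> 1" "tau p = ((y - d) / (1 - d), y / (1 - d))"
  then show ?thesis by (simp add: field_simps)
qed

lemma pappus_steiner_eq_iff:
  assumes "fst q \<noteq> snd q"
  shows "pappus_steiner q = pappus_steiner p \<longleftrightarrow> q = p \<or> q = tau p"
proof (rule coords)
  fix d y
  assume *: "p = (d + y, y)" "d \<noteq> 0" "d \<noteq> 1" "y \<noteq> 0"
    "tau p = ((y - d) / (1 - d), y / (1 - d))"
  define e z where "e = fst q - snd q" and "z = snd q"
  have q: "q = (e + z, z)" "e \<noteq> 0" using assms by (auto simp: e_def z_def)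
  have 2: "(2::'a) \<noteq> 0" using two_three_neq_0 char by blast
  have pi: "pappus_steiner (a + b, b) = (2 * (b / a) * ((2 - a) / a), (b / a)^2)" if "a \<noteq> 0" for a b :: 'a
    using that by (simp add: pappus_steiner_def power2_eq_square algebra_simps)
  have u: "pappus_steiner q = pappus_steiner p \<longleftrightarrow>
      (z / e) * ((2 - e) / e) = (y / d) * ((2 - d) / d) \<and> (z / e = y / d \<or> z / e = - (y / d))"
    using * q 2 by (simp add: pi power2_eq_iff del: times_divide_eq_left times_divide_eq_right)
  have "(z / e) * ((2 - e) / e) = (y / d) * ((2 - d) / d) \<longleftrightarrow> e = d" if "z / e = y / d"
  proof -
    have "y / d \<noteq> 0" using * by simp
    then have "(z / e) * ((2 - e) / e) = (y / d) * ((2 - d) / d) \<longleftrightarrow> (2 - e) / e = (2 - d) / d"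
      unfolding that by (simp only: mult_cancel_left) simp
    also have "\<dots> \<longleftrightarrow> 2 * e = 2 * d" using * q by (auto simp: field_simps)
    finally show ?thesis using 2 by simp
  qed
  moreover have "(z / e) * ((2 - e) / e) = (y / d) * ((2 - d) / d) \<longleftrightarrow> e * (1 - d) = - d"
    if "z / e = - (y / d)"
  proof -
    have "y / d \<noteq> 0" using * by simp
    then have "(z / e) * ((2 - e) / e) = (y / d) * ((2 - d) / d) \<longleftrightarrow> - ((2 - e) / e) = (2 - d) / d"
      unfolding that by (simp only: mult_minus_left mult_minus_right[symmetric] mult_cancel_left) simp
    also have "\<dots> \<longleftrightarrow> - ((2 - e) * d) = (2 - d) * e" using * q by (simp add: field_simps)
    also have "\<dots> \<longleftrightarrow> 2 * (e * (1 - d)) = 2 * (- d)" by algebra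
    finally show ?thesis using 2 by (simp only: mult_cancel_left) simp
  qed
  ultimately have "pappus_steiner q = pappus_steiner p \<longleftrightarrow>
      (z / e = y / d \<and> e = d) \<or> (z / e = - (y / d) \<and> e * (1 - d) = - d)"
    using u by blast
  also have "z / e = y / d \<and> e = d \<longleftrightarrow> q = p" using * q by auto
  also have "z / e = - (y / d) \<and> e * (1 - d) = - d \<longleftrightarrow> q = tau p"
  proof -
    have d: "1 - d \<noteq> 0" using * by simp
    have "z / e = - (y / d) \<and> e * (1 - d) = - d \<longleftrightarrow> e = - d / (1 - d) \<and> z / e = - (y / d)"
      unfolding eq_divide_eq using d by auto
    also have "\<dots> \<longleftrightarrow> e = - d / (1 - d) \<and> z = y / (1 - d)"
      using * q d by (auto simp: divide_eq_eq)
    also have "\<dots> \<longleftrightarrow> q = tau p"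
      unfolding *(5) q(1) using d by (auto simp: diff_divide_distrib eq_diff_eq eq_neg_iff_add_eq_0)
    finally show ?thesis .
  qed
  finally show ?thesis .
qed

lemma pappus_steiner_tau: "pappus_steiner (tau p) = pappus_steiner p"
  using pappus_steiner_eq_iff[OF tau_diff] by simp

lemma tau_neq: "tau p \<noteq> p"
proof (rule coords)
  fix d y
  assume *: "p = (d + y, y)" "d \<noteq> 0" "d \<noteq> 1" "y \<noteq> 0"
    "tau p = ((y - d) / (1 - d), y / (1 - d))"
  then show ?thesis by (auto simp: divide_eq_eq right_diff_distrib)
qed

lemma tau_mem: "tau p \<in> \<A> - H"
proof (rule coords)
  fix d y
  assume *: "d \<noteq> 1" "tau p = ((y - d) / (1 - d), y / (1 - d))"
  have "tau p \<in> \<A>"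
    using p mem_A_iff[of p] mem_A_iff[of "tau p"] pappus_steiner_tau tau_diff by simp
  moreover have "tau p \<notin> H" using * by (auto simp: H_def field_simps)
  ultimately show ?thesis by simp
qed

end

lemma tau_tau:
  fixes p :: "'a::field \<times> 'a"
  assumes "CHAR('a) \<noteq> 2" "CHAR('a) \<noteq> 3" "p \<in> \<A> - H"
  shows "tau (tau p) = p"
  using assms pappus_steiner_eq_iff[of p "tau (tau p)"] tau_diff[of "tau p"] tau_mem[of p]
    tau_neq[of "tau p"] pappus_steiner_tau[of p] pappus_steiner_tau[of "tau p"] by auto

text \<open>The excluded arguments \<open>-1, 2, 1/2\<close> of \<open>circ\<close> have \<open>j_inv = 1\<close>, which puts the
  point on the line \<open>x = y + 1\<close>. So they do not occur for points of \<open>\<A> - H\<close>.\<close>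

lemma circ_defined:
  fixes r s :: "'a::field"
  assumes char: "CHAR('a) \<noteq> 2" "CHAR('a) \<noteq> 3"
    and mem: "(j_inv r + j_inv s, j_inv r * j_inv s) \<in> \<A> - H"
  shows "r \<notin> {-1, 2, 1/2}" "s \<notin> {-1, 2, 1/2}"
proof -
  have 2: "(2::'a) \<noteq> 0" and 3: "(3::'a) \<noteq> 0" using two_three_neq_0 char by blast+
  have "(27::'a) = 3 ^ 3" "(4::'a) = 2 ^ 2" by simp_all
  then have 27: "(27::'a) \<noteq> 0" and 4: "(4::'a) \<noteq> 0" using 2 3 by (metis power_not_zero)+
  have j: "j_inv w = 1" if "w \<in> {-1, 2, 1/2}" for w :: 'a
  proof -
    have "w = -1 \<or> w = 2 \<or> 2 * w = 1" using that 2 by (auto simp: mult.commute)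
    then have eq: "4 * (w^2 - w + 1)^3 = 27 * w^2 * (w - 1)^2"
    proof (elim disjE)
      assume w: "2 * w = 1"
      have "4 * (4 * (w^2 - w + 1))^3 = 27 * (2 * w)^2 * (2 * w - 2)^2 * 4"
      proof -
        have "4 * (w^2 - w + 1) = (2 * w)^2 - 2 * (2 * w) + 4" by (simp add: algebra_simps power2_eq_square)
        then show ?thesis by (simp only: w) simp
      qed
      moreover have "4 * (4 * (w^2 - w + 1))^3 = 4^3 * (4 * (w^2 - w + 1)^3)"
        unfolding power_mult_distrib by (rule mult.left_commute)
      moreover have "27 * (2 * w)^2 * (2 * w - 2)^2 * 4 = 4^3 * (27 * w^2 * (w - 1)^2)"
        by (simp add: algebra_simps power2_eq_square)
      ultimately show ?thesis using 4 by (metis mult_cancel_left power_not_zero)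
    qed simp_all
    have "(2::'a) \<noteq> 1" by (metis add_cancel_left_left one_add_one zero_neq_one)
    then have "w \<noteq> 0" "w - 1 \<noteq> 0" using that 2 by (auto simp: divide_eq_eq)
    then show ?thesis using eq 27 by (simp add: j_inv_def)
  qed
  show "r \<notin> {-1, 2, 1/2}" "s \<notin> {-1, 2, 1/2}"
    using mem j[of r] j[of s] by (auto simp: H_def)
qed

lemma circ_not_0_1:
  fixes w :: "'a::field"
  assumes "CHAR('a) \<noteq> 2" "CHAR('a) \<noteq> 3" "w \<notin> {-1, 2, 1/2}"
  shows "1 + w \<noteq> 0" "circ w \<notin> {0, 1}"
proof -
  show 1: "1 + w \<noteq> 0" using assms(3) by (auto simp: add_eq_0_iff)
  have "2 * w \<noteq> 1" using assms(3) two_three_neq_0[OF assms(1,2)] by (auto simp: field_simps)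
  moreover have "2 - w = 1 + w \<longleftrightarrow> 2 * w = 1" by algebra
  ultimately show "circ w \<notin> {0, 1}" using assms(3) 1 by (auto simp: circ_def)
qed

end

(* On the j-line, the map w \<mapsto> (2 - w) / (1 + w) acts as the involution j \<mapsto> j / (j - 1), since
   4 (w^2 - w + 1)^3 - 27 w^2 (w - 1)^2 = ((w + 1) (w - 2) (2 w - 1))^2. In the coordinates
   [x, y] = [a + b, a b] the denominator y - x + 1 of tau factors as (a - 1) (b - 1), so tau
   applies the same involution to a and b. *)

theory Submission
  imports Defs
begin

text \<open>Besides giving the denominator of the involution, the factored numerator shows that
  \<open>j_inv w\<close> is 1 as soon as \<open>1 + w\<close>, \<open>2 - w\<close> or
  \<open>1 - 2 * w\<close> vanishes.\<close>

lemma j_inv_minus_1: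
  fixes w :: "'a::field"
  assumes "(27::'a) \<noteq> 0" "w \<notin> {0, 1}"
  shows "j_inv w - 1 = ((w + 1) * (w - 2) * (2 * w - 1))^2 / (27 * w^2 * (w - 1)^2)"
proof -
  have "27 * w^2 * (w - 1)^2 \<noteq> 0"
    using assms by simp
  moreover have "4 * (w^2 - w + 1)^3 - 27 * w^2 * (w - 1)^2 = ((w + 1) * (w - 2) * (2 * w - 1))^2"
    by algebra
  ultimately show ?thesis
    unfolding j_inv_def by (metis diff_divide_distrib divide_self)
qed

text \<open>Both sides reduce to \<open>4 * N^3\<close> over the squared product of those three
  factors.\<close>

lemma j_inv_circ:
  fixes w :: "'a::field"
  assumes "(27::'a) \<noteq> 0" "w \<notin> {0, 1}" "j_inv w \<noteq> 1"
  shows "j_inv (circ w) = j_inv w / (j_inv w - 1)"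
proof -
  define N where "N = w^2 - w + 1"
  have nz: "1 + w \<noteq> 0" "2 - w \<noteq> 0" "1 - 2 * w \<noteq> 0"
    using assms j_inv_minus_1[of w] by (auto simp: add.commute)
  have "circ w ^ 2 - circ w + 1 = 3 * N / (1 + w)^2"
  proof -
    have "(v / u)^2 - v / u + 1 = (v^2 - v * u + u^2) / u^2" if "u \<noteq> 0" for u v :: 'a
      using that by (simp add: field_simps power2_eq_square)
    moreover have "(2 - w)^2 - (2 - w) * (1 + w) + (1 + w)^2 = 3 * N"
      unfolding N_def by algebra
    ultimately show ?thesis using nz(1) by (simp only: circ_def not_False_eq_True)
  qed
  moreover have "circ w - 1 = (1 - 2 * w) / (1 + w)"
    using nz(1) unfolding circ_def by (simp add: field_simps)
  ultimately have "j_inv (circ w)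
      = 4 * (3 * N / (1 + w)^2)^3 / (27 * ((2 - w) / (1 + w))^2 * ((1 - 2 * w) / (1 + w))^2)"
    by (simp add: j_inv_def circ_def)
  \<comment> \<open>The cube of 3 cancels 27, and of the six powers of \<open>1 + w\<close> two
    survive.\<close>
  also have "\<dots> = 4 * N^3 / ((1 + w) * (2 - w) * (1 - 2 * w))^2"
  proof -
    have "4 * (3 * N / u^2)^3 / (27 * (v / u)^2 * (t / u)^2) = 4 * N^3 / (u * v * t)^2"
      if "u \<noteq> 0" "v \<noteq> 0" "t \<noteq> 0" for u v t :: 'a
      using that assms(1) by (simp add: field_simps power2_eq_square power3_eq_cube)
    then show ?thesis using nz by blast
  qed
  also have "((1 + w) * (2 - w) * (1 - 2 * w))^2 = ((w + 1) * (w - 2) * (2 * w - 1))^2"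
    by algebra
  \<comment> \<open>Dividing numerator and denominator by \<open>27 * w^2 * (w - 1)^2\<close> yields
    \<open>j_inv w\<close> and \<open>j_inv w - 1\<close>.\<close>
  also have "4 * N^3 / \<dots> = j_inv w / (j_inv w - 1)"
  proof -
    have "27 * w^2 * (w - 1)^2 \<noteq> 0"
      using assms(1,2) by simp
    moreover have "a / q = (a / d) / (q / d)" if "d \<noteq> 0" for a q d :: 'a
      using that by simp
    ultimately show ?thesis
      unfolding j_inv_minus_1[OF assms(1,2)] unfolding j_inv_def N_def by blast
  qed
  finally show ?thesis .
qed

text \<open>Over the common denominator \<open>(a - 1) * (b - 1)\<close>, the sum of the two images
  has numerator \<open>2 * (a * b) - (a + b)\<close>, as in \<open>tau\<close>.\<close>

lemma tau_sum_prod: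
  fixes a b :: "'a::field"
  assumes "a \<noteq> 1" "b \<noteq> 1"
  shows "tau (a + b, a * b) = (a / (a - 1) + b / (b - 1), a / (a - 1) * (b / (b - 1)))"
proof -
  have "a * b - (a + b) + 1 = (a - 1) * (b - 1)" by algebra
  moreover have "2 * (a * b) - (a + b) = a * (b - 1) + b * (a - 1)" by algebra
  ultimately show ?thesis
    using assms by (simp add: tau_def add_frac_eq)
qed

theorem proposition3p3:
  fixes r s x y :: "'a::field"
  assumes "CHAR('a) \<noteq> 2" and "CHAR('a) \<noteq> 3"
    and "r \<notin> {0, 1}" and "s \<notin> {0, 1}"
    and "(x, y) = (j_inv r + j_inv s, j_inv r * j_inv s)"
    and "(x, y) \<in> \<A> - H"
  shows "tau (x, y) = (j_inv (circ r) + j_inv (circ s), j_inv (circ r) * j_inv (circ s))"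
proof -
  have "(3::'a) ^ 3 \<noteq> 0"
    using two_three_neq_0[OF assms(1,2)] by (metis power_not_zero)
  then have 27: "(27::'a) \<noteq> 0" by simp
  \<comment> \<open>If either value were 1, then \<open>x = y + 1\<close>, so the point would lie on
    \<open>H\<close>.\<close>
  have "j_inv r \<noteq> 1" "j_inv s \<noteq> 1"
    using assms(5,6) by (auto simp: H_def)
  then show ?thesis
    unfolding assms(5) using assms(3,4) 27 by (simp only: tau_sum_prod j_inv_circ not_False_eq_True)
qed

end
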